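(* Let $\xi$ be a reproduction point process on $[0,\infty)$ (locally finite, with $\mathbf{P}(\xi\{0\}=1)<1$) with intensity measure $\mu$, and put $\mu_+(t)=\mu((0,t])$. Assume that $\mu(\{0\})=1$, that $\mu_+(t_0)<\infty$ for some $t_0>0$, that $\mu_+(t)>0$ for all $t>0$, and that $\mathbf{E}[\xi[0,\varepsilon]^2]<\infty$ for some $\varepsilon>0$. Assume further that $$\liminf_{t\downarrow 0}\frac{\mu_+(t)}{t\,|\log t|^{1+\delta}}>0\quad\text{for some }\delta>0.$$ Then $\xi$ yields an explosive CMJ process.
   Context: A reproduction point process $\xi$ is a random point measure on $[0,\infty)$ that is locally finite: $\xi[0,t]<\infty$ almost surely for all $t\ge 0$. Its intensity measure is $\mu(B)=\mathbf{E}[\xi(B)]$ for Borel $B$. Write $\xi=\sum_{j=1}^N\delta_{X_j}$ with $N=\xi[0,\infty)\in\mathbb{N}_0\cup\{\infty\}$ and $X_j=\inf\{t\ge 0:\xi[0,t]\ge j\}$ ($\inf\varnothing=\infty$). Crump-Mode-Jagers (CMJ) process driven by $\xi$: let $\mathcal{I}=\{\varnothing\}\cup\bigcup_{n\in\mathbb{N}}\mathbb{N}^n$ be the set of labels, and let $(\xi_u)_{u\in\mathcal{I}}$ be i.i.d. copies of $\xi$, with $X_{u,j}$ defined from $\xi_u$ as $X_j$ is from $\xi$. Birth times are $S(\varnothing)=0$ and $S(uj)=S(u)+X_{u,j}$ for $u\in\mathcal{I}$, $j\in\mathbb{N}$ (individuals with $S(u)=\infty$ are never born). Let $\mathcal{Z}_t=\#\{u\in\mathcal{I}:S(u)\le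 t\}$ and let $T=\inf\{t\ge 0:\mathcal{Z}_t=\infty\}\in[0,\infty]$ be the explosion time. One says that $\xi$ yields an explosive CMJ process if $\mathbf{P}(T<\infty)>0$. *)

theory Defs
  imports "HOL-Probability.Probability"
begin

section \<open>Point processes on the half-line\<close>

abbreviation half_line :: "real measure" where
  "half_line \<equiv> restrict_space borel {0..}"

text \<open>
  Point measures are the measures with values in \<open>{0, 1, 2, \<dots>, \<infinity>}\<close>. Their space carries the
  \<sigma>-algebra generated by the evaluations \<open>m \<mapsto> m(A)\<close>, in the same way as
  \<^const>\<open>subprob_algebra\<close>. Local finiteness is an almost sure property of the process and is
  therefore not built into the space.
\<close>

definition point_measure_algebra :: "'a measure \<Rightarrow> 'a measure measure" where
  "point_measure_algebra K =
    (SUP A \<in> sets K. vimage_algebra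
      {m. sets m = sets K \<and> (\<forall>B\<in>sets K. emeasure m B \<in> range of_nat \<union> {\<infinity>})}
      (\<lambda>m. emeasure m A) borel)"

definition reproduction_process :: "'a measure \<Rightarrow> ('a \<Rightarrow> real measure) \<Rightarrow> bool" where
  "reproduction_process M \<xi> \<longleftrightarrow>
    prob_space M \<and>
    \<xi> \<in> M \<rightarrow>\<^sub>M point_measure_algebra half_line \<and>
    (\<forall>t\<ge>0. AE \<omega> in M. emeasure (\<xi> \<omega>) {0..t} < \<infinity>)"

definition intensity :: "'a measure \<Rightarrow> ('a \<Rightarrow> real measure) \<Rightarrow> real set \<Rightarrow> ennreal" where
  "intensity M \<xi> B = (\<integral>\<^sup>+\<omega>. emeasure (\<xi> \<omega>) B \<partial>M)"

text \<open>The \<open>j\<close>-th point, for \<open>j \<ge> 1\<close>; it is \<open>\<infinity>\<close> (the infimum of the empty set) if the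
  measure has fewer than \<open>j\<close> points.\<close>

definition nth_point :: "real measure \<Rightarrow> nat \<Rightarrow> ennreal" where
  "nth_point m j = Inf {ennreal t | t. 0 \<le> t \<and> of_nat j \<le> emeasure m {0..t}}"


section \<open>Crump-Mode-Jagers processes\<close>

definition labels :: "nat list set" where
  "labels = lists {1..}"

definition iid_copies ::
    "'a measure \<Rightarrow> ('a \<Rightarrow> real measure) \<Rightarrow> 'b measure \<Rightarrow> (nat list \<Rightarrow> 'b \<Rightarrow> real measure) \<Rightarrow> bool" where
  "iid_copies M \<xi> Q \<Xi> \<longleftrightarrow>
    prob_space Q \<and>
    prob_space.indep_vars Q (\<lambda>_. point_measure_algebra half_line) \<Xi> labels \<and>
    (\<forall>u\<in>labels. distr Q (point_measure_algebra half_line) (\<Xi> u)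
              = distr M (point_measure_algebra half_line) \<xi>)"

text \<open>In the following \<open>x u\<close> is the point measure of the children of \<open>u\<close>, and the \<open>j\<close>-th child
  of \<open>u\<close> has the label \<open>u @ [j]\<close>.\<close>

fun birth_time :: "(nat list \<Rightarrow> real measure) \<Rightarrow> nat list \<Rightarrow> ennreal" where
  "birth_time x u =
    (if u = [] then 0 else birth_time x (butlast u) + nth_point (x (butlast u)) (last u))"

declare birth_time.simps [simp del]

lemma birth_time_Nil [simp]: "birth_time x [] = 0"
  by (simp add: birth_time.simps)

lemma birth_time_snoc [simp]: "birth_time x (u @ [j]) = birth_time x u + nth_point (x u) j"
  by (subst birth_time.simps) simp

definition num_born :: "(nat list \<Rightarrow> real measure) \<Rightarrow> real \<Rightarrow> ennreal" where
  "num_born x t = emeasure (count_space UNIV) {u \<in> labels. birth_time x u \<le> ennreal t}"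

definition explosion_time :: "(nat list \<Rightarrow> real measure) \<Rightarrow> ennreal" where
  "explosion_time x = Inf {ennreal t | t. 0 \<le> t \<and> num_born x t = \<infinity>}"

definition explosive_CMJ :: "'b measure \<Rightarrow> (nat list \<Rightarrow> 'b \<Rightarrow> real measure) \<Rightarrow> bool" where
  "explosive_CMJ Q \<Xi> \<longleftrightarrow>
    measure Q {\<omega> \<in> space Q. explosion_time (\<lambda>u. \<Xi> u \<omega>) < \<infinity>} > 0"


text \<open>Families of i.i.d. copies exist: the coordinates of the product space of the law of \<open>\<xi>\<close>.\<close>

lemma iid_copies_product:
  assumes "reproduction_process M \<xi>"
  shows "iid_copies M \<xi> (\<Pi>\<^sub>M u\<in>labels. distr M (point_measure_algebra half_line) \<xi>) (\<lambda>u \<omega>. \<omega> u)"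
proof -
  let ?N = "point_measure_algebra half_line"
  let ?L = "distr M ?N \<xi>"
  let ?P = "\<Pi>\<^sub>M u\<in>labels. ?L"
  have L: "prob_space ?L"
    using assms by (auto simp: reproduction_process_def intro: prob_space.prob_space_distr)
  interpret P: prob_space ?P
    by (rule prob_space_PiM) (rule L)
  have marg: "distr ?P ?N (\<lambda>\<omega>. \<omega> u) = ?L" if "u \<in> labels" for u
  proof -
    have "distr ?P ?N (\<lambda>\<omega>. \<omega> u) = distr ?P ?L (\<lambda>\<omega>. \<omega> u)"
      by (rule distr_cong) auto
    also have "\<dots> = ?L"
      using that by (intro distr_PiM_component L)
    finally show ?thesis .
  qed
  have "P.indep_vars (\<lambda>_. ?N) (\<lambda>u \<omega>. \<omega> u) labels"
  proof (subst P.indep_vars_iff_distr_eq_PiM')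
    show "labels \<noteq> {}"
      by (auto simp: labels_def)
    show "(\<lambda>\<omega>. \<omega> u) \<in> ?P \<rightarrow>\<^sub>M ?N" if "u \<in> labels" for u
      using measurable_component_singleton[OF that, of "\<lambda>_. ?L"] by simp
    have "distr ?P (\<Pi>\<^sub>M u\<in>labels. ?N) (\<lambda>\<omega>. \<lambda>u\<in>labels. \<omega> u) = distr ?P ?P (\<lambda>\<omega>. \<omega>)"
      by (rule distr_cong) (auto simp: space_PiM intro!: sets_PiM_cong)
    also have "\<dots> = ?P"
      by simp
    also have "\<dots> = (\<Pi>\<^sub>M u\<in>labels. distr ?P ?N (\<lambda>\<omega>. \<omega> u))"
      by (rule PiM_cong) (auto simp: marg)
    finally show "distr ?P (\<Pi>\<^sub>M u\<in>labels. ?N) (\<lambda>\<omega>. \<lambda>u\<in>labels. \<omega> u)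
      = (\<Pi>\<^sub>M u\<in>labels. distr ?P ?N (\<lambda>\<omega>. \<omega> u))" .
  qed
  then show ?thesis
    unfolding iid_copies_def using P.prob_space_axioms marg by blast
qed

end

theory Submission
  imports Defs
begin

text \<open>
  Let \<open>q\<^sub>n(t)\<close> be the probability that generation \<open>n\<close> is reached by time \<open>t\<close>. A linear function
  \<open>g(t) = a t\<close> with small \<open>a\<close> satisfies \<open>q\<^sub>n \<ge> g\<close> near \<open>0\<close> for all \<open>n\<close>: counting only the
  children born at time \<open>0\<close>, who keep the whole time \<open>t\<close>, and those born in \<open>(0, t/2]\<close>, who keep
  at least \<open>t/2\<close>, the second-order expansion of the product over the children gives
  \<open>q\<^sub>n\<^sub>+\<^sub>1(t) \<ge> g(t) \<mu>{0} + g(t/2) \<mu>(0, t/2] - g(t)\<^sup>2 E[\<xi>[0, t/2]\<^sup>2] / 2\<close>.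
  Here \<open>\<mu>{0} = 1\<close> and \<open>\<mu>(0, t] \<ge> c t\<close> near \<open>0\<close>, so the two remaining terms are both of order
  \<open>t\<^sup>2\<close> and the positive one wins if \<open>a\<close> is small. By continuity from above, with positive
  probability all generations are reached in finite time.
\<close>

section \<open>Measurability of point measures and birth times\<close>

lemma space_point_measure_algebra:
  "space (point_measure_algebra K) =
    {m. sets m = sets K \<and> (\<forall>B\<in>sets K. emeasure m B \<in> range of_nat \<union> {\<infinity>})}"
  by (auto simp: point_measure_algebra_def space_Sup_eq_UN)

lemma measurable_emeasure_point_measure_algebra [measurable]:
  "A \<in> sets K \<Longrightarrow> (\<lambda>m. emeasure m A) \<in> borel_measurable (point_measure_algebra K)"
  by (auto intro!: measurable_Sup1 measurable_vimage_algebra1 simp: point_measure_algebra_def)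

lemma half_line_sets [measurable]:
  "{0} \<in> sets half_line" "{0..t} \<in> sets half_line" "{0<..t} \<in> sets half_line"
  by (auto simp: sets_restrict_space_iff)

lemma point_measure_split:
  assumes "m \<in> space (point_measure_algebra half_line)" "0 \<le> t"
  shows "emeasure m {0..t} = emeasure m {0} + emeasure m {0<..t}"
proof -
  have "sets m = sets half_line"
    using assms by (simp add: space_point_measure_algebra)
  moreover have "{0..t} = {0} \<union> {0<..t}"
    using assms by auto
  ultimately show ?thesis
    by (simp add: plus_emeasure)
qed

lemma point_measure_eq_of_nat:
  assumes "m \<in> space (point_measure_algebra K)" "A \<in> sets K" "emeasure m A < \<infinity>"
  obtains k where "emeasure m A = of_nat k"
  using assms by (auto simp: space_point_measure_algebra)

lemma nth_point_le:
  "0 \<le> t \<Longrightarrow> of_nat j \<le> emeasure m {0..t} \<Longrightarrow> nth_point m j \<le> ennreal t"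
  unfolding nth_point_def by (rule Inf_lower) blast

text \<open>Since the inequality is strict and \<open>emeasure m {0..t}\<close> grows with
  \<open>t\<close>, a real witness can be enlarged slightly to a rational one. The event becomes a
  countable union, which is what measurability needs.\<close>

lemma nth_point_less_iff:
  assumes "m \<in> space (point_measure_algebra half_line)"
  shows "nth_point m j < a \<longleftrightarrow>
    (\<exists>q::rat. 0 \<le> q \<and> ennreal (of_rat q) < a \<and> of_nat j \<le> emeasure m {0..of_rat q})"
proof
  assume "nth_point m j < a"
  then obtain t where t: "0 \<le> t" "ennreal t < a" "of_nat j \<le> emeasure m {0..t}"
    unfolding nth_point_def Inf_less_iff by blast
  \<comment> \<open>\<open>a\<close> may be infinite, so a real bound is chosen between
    \<open>t\<close> and \<open>a\<close> before density of the rationals is applied.\<close>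
  obtain b where b: "t < b" "ennreal b \<le> a"
  proof (cases a)
    case (real r)
    then show ?thesis using t that[of r] by (auto simp: ennreal_less_iff)
  next
    case top
    then show ?thesis using that[of "t + 1"] by simp
  qed
  obtain q :: rat where q: "t < of_rat q" "of_rat q < b"
    using of_rat_dense[OF b(1)] by blast
  have "emeasure m {0..t} \<le> emeasure m {0..of_rat q}"
    using assms q by (intro emeasure_mono) (auto simp: space_point_measure_algebra)
  moreover have "ennreal (of_rat q) < a"
    using q t by (intro less_le_trans[OF _ b(2)] ennreal_lessI) auto
  moreover have "0 \<le> q"
    using t q by (metis less_eq_real_def order.trans zero_le_of_rat_iff)
  ultimately show "\<exists>q::rat. 0 \<le> q \<and> ennreal (of_rat q) < a \<and> of_nat j \<le> emeasure m {0..of_rat q}"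
    using t by (intro exI[of _ q]) auto
next
  assume "\<exists>q::rat. 0 \<le> q \<and> ennreal (of_rat q) < a \<and> of_nat j \<le> emeasure m {0..of_rat q}"
  then show "nth_point m j < a"
    by (meson le_less_trans nth_point_le zero_le_of_rat_iff)
qed

lemma measurable_nth_point [measurable]:
  "(\<lambda>m. nth_point m j) \<in> borel_measurable (point_measure_algebra half_line)"
proof (rule borel_measurableI_less)
  fix a
  have "{m \<in> space (point_measure_algebra half_line).
      \<exists>q::rat. 0 \<le> q \<and> ennreal (of_rat q) < a \<and> of_nat j \<le> emeasure m {0..of_rat q}}
    \<in> sets (point_measure_algebra half_line)"
    by measurable
  then show "{m \<in> space (point_measure_algebra half_line). nth_point m j < a}
    \<in> sets (point_measure_algebra half_line)"
    by (simp add: nth_point_less_iff cong: conj_cong)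
qed

lemma snoc_in_labels [simp]: "u @ v \<in> labels \<longleftrightarrow> u \<in> labels \<and> v \<in> labels"
  by (auto simp: labels_def)

lemma singleton_in_labels [simp]: "[j] \<in> labels \<longleftrightarrow> 1 \<le> j"
  by (auto simp: labels_def)

lemma Nil_in_labels [simp]: "[] \<in> labels"
  by (auto simp: labels_def)

lemma measurable_birth_time:
  assumes X: "\<And>v. v \<in> labels \<Longrightarrow> X v \<in> R \<rightarrow>\<^sub>M point_measure_algebra half_line"
  shows "u \<in> labels \<Longrightarrow> (\<lambda>r. birth_time (\<lambda>v. X v r) u) \<in> borel_measurable R"
proof (induction u rule: rev_induct)
  case (snoc j u)
  then have "(\<lambda>r. nth_point (X u r) j) \<in> borel_measurable R"
    by (intro measurable_compose[OF X measurable_nth_point]) auto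
  with snoc show ?case
    by simp
qed simp

text \<open>\<open>num_born\<close> is monotone in time, so integer times suffice and the quantifier
  over times becomes countable.\<close>

lemma explosion_time_finite_iff:
  "explosion_time x < \<infinity> \<longleftrightarrow> (\<exists>n::nat. num_born x (real n) = \<infinity>)"
proof
  assume "explosion_time x < \<infinity>"
  then obtain t where t: "num_born x t = \<infinity>"
    unfolding explosion_time_def Inf_less_iff by blast
  obtain n :: nat where "t \<le> real n"
    using real_arch_simple by blast
  then have "num_born x t \<le> num_born x (real n)"
    unfolding num_born_def
    by (intro emeasure_mono) (auto intro: order.trans[OF _ ennreal_leI])
  with t show "\<exists>n::nat. num_born x (real n) = \<infinity>"
    by (auto simp: top_unique)
next
  assume "\<exists>n::nat. num_born x (real n) = \<infinity>"
  then obtain n :: nat where "num_born x (real n) = \<infinity>" ..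
  then have "explosion_time x \<le> ennreal (real n)"
    unfolding explosion_time_def by (intro Inf_lower) auto
  then show "explosion_time x < \<infinity>"
    using ennreal_less_top le_less_trans by (metis infinity_ennreal_def)
qed

text \<open>A set is infinite iff no finite set covers it. Finite sets are encoded as lists because
  the lists of labels form a countable type, which again keeps the quantifier countable.\<close>

lemma num_born_infinite_iff:
  "num_born x t = \<infinity> \<longleftrightarrow>
    (\<forall>F::nat list list. \<exists>u. u \<in> labels \<and> u \<notin> set F \<and> birth_time x u \<le> ennreal t)"
proof -
  let ?A = "{u \<in> labels. birth_time x u \<le> ennreal t}"
  have "num_born x t = \<infinity> \<longleftrightarrow> infinite ?A"
    by (simp add: num_born_def emeasure_count_space)
  also have "\<dots> \<longleftrightarrow> (\<forall>F::nat list list. \<not> ?A \<subseteq> set F)"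
  proof
    show "\<forall>F::nat list list. \<not> ?A \<subseteq> set F" if "infinite ?A"
      using that infinite_super by (intro allI notI) blast
    show "infinite ?A" if "\<forall>F::nat list list. \<not> ?A \<subseteq> set F"
      using that finite_list[of ?A] by (intro notI) auto
  qed
  finally show ?thesis
    by blast
qed

text \<open>\<open>explosive_CMJ\<close> is stated with \<open>measure\<close>, and bounding it from
  below by the measure of a smaller event requires explosion to be an event.\<close>

lemma measurable_explosion:
  assumes X: "\<And>v. v \<in> labels \<Longrightarrow> X v \<in> R \<rightarrow>\<^sub>M point_measure_algebra half_line"
  shows "{r \<in> space R. explosion_time (\<lambda>v. X v r) < \<infinity>} \<in> sets R"
proof -
  have [measurable]: "(\<lambda>r. birth_time (\<lambda>v. X v r) u) \<in> borel_measurable R" if "u \<in> labels" for u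
    by (rule measurable_birth_time) (use X that in auto)
  have "Measurable.pred R (\<lambda>r. u \<in> labels \<and> u \<notin> set F \<and> birth_time (\<lambda>v. X v r) u \<le> ennreal t)" for u F t
    by (cases "u \<in> labels") auto
  then have "Measurable.pred R (\<lambda>r. num_born (\<lambda>v. X v r) t = \<infinity>)" for t
    unfolding num_born_infinite_iff
    by (intro pred_intros_countable)
  then show ?thesis
    unfolding explosion_time_finite_iff by (intro predE pred_intros_countable)
qed

section \<open>A subtree that survives\<close>

text \<open>
  The time budget \<open>t\<close> passes in full to a child born at time \<open>0\<close> and is halved for any other child
  born by \<open>t/2\<close>, so survival is a lower bound for reaching generation \<open>n\<close> below \<open>u\<close> within time \<open>t\<close>.
\<close>

fun survives :: "nat \<Rightarrow> nat list \<Rightarrow> real \<Rightarrow> (nat list \<Rightarrow> real measure) \<Rightarrow> bool" where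
  "survives 0 u t x \<longleftrightarrow> True"
| "survives (Suc n) u t x \<longleftrightarrow>
    (\<exists>j\<ge>1. of_nat j \<le> emeasure (x u) {0} \<and> survives n (u @ [j]) t x \<or>
           of_nat j \<le> emeasure (x u) {0..t / 2} \<and> survives n (u @ [j]) (t / 2) x)"

text \<open>Makes the survival events decrease in \<open>n\<close>, as continuity from above
  requires.\<close>

lemma survives_Suc_imp: "survives (Suc n) u t x \<Longrightarrow> survives n u t x"
proof (induction n arbitrary: u t)
  case (Suc n)
  have "survives (Suc n) (u @ [j]) s x \<Longrightarrow> survives n (u @ [j]) s x" for j s
    by (rule Suc.IH)
  with Suc.prems show ?case
    unfolding survives.simps(2)[of "Suc n"] survives.simps(2)[of n u] by blast
qed simp

lemma survives_imp_born:
  "survives n u t x \<Longrightarrow> 0 \<le> t \<Longrightarrow>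
    \<exists>v\<in>labels. length v = n \<and> birth_time x (u @ v) \<le> birth_time x u + ennreal t"
proof (induction n arbitrary: u t)
  case 0
  show ?case by (intro bexI[of _ "[]"]) auto
next
  case (Suc n)
  \<comment> \<open>Here \<open>s\<close> bounds the birth delay of the child and
    \<open>t - s\<close> is the budget left to it. The two alternatives of \<open>survives\<close>
    are the cases \<open>s = 0\<close> and \<open>s = t / 2\<close>.\<close>
  have step: ?case
    if j: "1 \<le> j" "0 \<le> s" "s \<le> t" "of_nat j \<le> emeasure (x u) {0..s}" "survives n (u @ [j]) (t - s) x" for j s
  proof -
    obtain v where v: "v \<in> labels" "length v = n"
      "birth_time x ((u @ [j]) @ v) \<le> birth_time x (u @ [j]) + ennreal (t - s)"
      using Suc.IH[OF j(5)] j by auto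
    have "birth_time x (u @ [j]) \<le> birth_time x u + ennreal s"
      using nth_point_le[OF j(2,4)] by (simp add: add_left_mono)
    then have "birth_time x ((u @ [j]) @ v) \<le> birth_time x u + ennreal s + ennreal (t - s)"
      using v(3) by (meson add_right_mono order.trans)
    also have "\<dots> = birth_time x u + ennreal t"
      using j by (simp add: add.assoc flip: ennreal_plus)
    finally show ?thesis
      using v j by (intro bexI[of _ "j # v"]) (auto simp: labels_def)
  qed
  from Suc.prems obtain j where "1 \<le> j"
    "of_nat j \<le> emeasure (x u) {0..0} \<and> survives n (u @ [j]) (t - 0) x \<or>
     of_nat j \<le> emeasure (x u) {0..t / 2} \<and> survives n (u @ [j]) (t - t / 2) x"
    by auto
  then show ?case
    using step[of j 0] step[of j "t / 2"] Suc.prems by auto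
qed

section \<open>Locality and measurability of survival\<close>

definition subtree :: "nat list \<Rightarrow> nat list set" where
  "subtree u = (\<lambda>v. u @ v) ` labels"

lemma self_in_subtree: "u \<in> subtree u"
  by (auto simp: subtree_def image_iff)

lemma subtree_snoc_subset: "1 \<le> j \<Longrightarrow> subtree (u @ [j]) \<subseteq> subtree u"
  by (auto simp: subtree_def image_iff labels_def)

lemma subtree_subset_labels: "u \<in> labels \<Longrightarrow> subtree u \<subseteq> labels"
  by (auto simp: subtree_def)

text \<open>Survival below \<open>u\<close> reads only labels that extend \<open>u\<close>. Hence
  survival below distinct children is determined by disjoint sets of copies, the source of
  independence in the recursion.\<close>

lemma survives_cong:
  "(\<And>v. v \<in> subtree u \<Longrightarrow> x v = y v) \<Longrightarrow> survives n u t x \<longleftrightarrow> survives n u t y"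
proof (induction n arbitrary: u t)
  case (Suc n)
  have "survives n (u @ [j]) s x \<longleftrightarrow> survives n (u @ [j]) s y" if "1 \<le> j" for j s
    using subtree_snoc_subset[OF that] by (intro Suc.IH Suc.prems) auto
  then show ?case
    using Suc.prems[OF self_in_subtree] by (auto simp del: One_nat_def)
qed simp

lemma measurable_survives:
  "(\<And>v. v \<in> subtree u \<Longrightarrow> X v \<in> R \<rightarrow>\<^sub>M point_measure_algebra half_line) \<Longrightarrow>
    Measurable.pred R (\<lambda>r. survives n u t (\<lambda>v. X v r))"
proof (induction n arbitrary: u t)
  case (Suc n)
  have [measurable]: "Measurable.pred R (\<lambda>r. survives n (u @ [j]) s (\<lambda>v. X v r))" if "1 \<le> j" for j s
    using subtree_snoc_subset[OF that] by (intro Suc.IH Suc.prems) auto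
  have [measurable]: "X u \<in> R \<rightarrow>\<^sub>M point_measure_algebra half_line"
    by (rule Suc.prems[OF self_in_subtree])
  have [measurable]: "(\<lambda>r. emeasure (X u r) A) \<in> borel_measurable R" if "A \<in> sets half_line" for A
    using that by measurable
  have "Measurable.pred R (\<lambda>r. 1 \<le> j \<and>
      (of_nat j \<le> emeasure (X u r) {0} \<and> survives n (u @ [j]) t (\<lambda>v. X v r) \<or>
       of_nat j \<le> emeasure (X u r) {0..t / 2} \<and> survives n (u @ [j]) (t / 2) (\<lambda>v. X v r)))" for j
    by (cases "1 \<le> j") auto
  then show ?case
    unfolding survives.simps by (rule pred_intros_countable)
qed simp

section \<open>The recursion for survival probabilities\<close>

context prob_space
begin

text \<open>If survival below \<open>u\<close> fails, it fails below each of the first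
  \<open>y + z\<close> children: the first \<open>y\<close> are born at time 0 and keep
  \<open>t\<close>, the others are born by \<open>t / 2\<close> and keep \<open>t / 2\<close>. These
  failures and the offspring counts of \<open>u\<close> depend on disjoint sets of labels, so their
  probabilities multiply. Stating the bound for intersections avoids conditioning on a null
  event.\<close>

lemma prob_extinct_given_offspring:
  fixes y z :: nat and p :: real
  assumes ind: "indep_vars (\<lambda>_. point_measure_algebra half_line) \<Xi> labels"
    and u: "u \<in> labels" and t: "0 \<le> t" and p: "0 \<le> p" "p \<le> 1"
    and full: "\<And>j. 1 \<le> j \<Longrightarrow> p \<le> prob {\<omega> \<in> space M. survives n (u @ [j]) t (\<lambda>v. \<Xi> v \<omega>)}"
    and half: "\<And>j. 1 \<le> j \<Longrightarrow> p / 2 \<le> prob {\<omega> \<in> space M. survives n (u @ [j]) (t / 2) (\<lambda>v. \<Xi> v \<omega>)}"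
  shows "prob {\<omega> \<in> space M. emeasure (\<Xi> u \<omega>) {0} = of_nat y \<and> emeasure (\<Xi> u \<omega>) {0<..t / 2} = of_nat z
           \<and> \<not> survives (Suc n) u t (\<lambda>v. \<Xi> v \<omega>)}
      \<le> prob {\<omega> \<in> space M. emeasure (\<Xi> u \<omega>) {0} = of_nat y \<and> emeasure (\<Xi> u \<omega>) {0<..t / 2} = of_nat z}
         * ((1 - p) ^ y * (1 - p / 2) ^ z)"
proof -
  let ?N = "point_measure_algebra half_line"
  define s where "s j = (if j \<le> y then t else t / 2)" for j
  \<comment> \<open>Children are numbered from 1, so index 0 is free for the block
    \<open>{u}\<close> that carries the offspring counts.\<close>
  define K where "K j = (if j = 0 then {u} else subtree (u @ [j]))" for j
  \<comment> \<open>Restriction turns block \<open>j\<close> into a random element of the product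
    over \<open>K j\<close>, and disjoint blocks of an independent family are independent.\<close>
  define X where "X j \<omega> = restrict (\<lambda>v. \<Xi> v \<omega>) (K j)" for j \<omega>
  define D where "D x \<longleftrightarrow> emeasure (x u) {0} = of_nat y \<and> emeasure (x u) {0<..t / 2} = of_nat z"
    for x :: "nat list \<Rightarrow> real measure"
  define P where "P j x \<longleftrightarrow> (if j = 0 then D x else \<not> survives n (u @ [j]) (s j) x)" for j x
  define A where "A j = {x \<in> space (PiM (K j) (\<lambda>_. ?N)). P j x}" for j
  have \<Xi>: "\<Xi> v \<in> M \<rightarrow>\<^sub>M ?N" if "v \<in> labels" for v
    using ind that by (auto simp: indep_vars_def)
  have K_labels: "K j \<subseteq> labels" for j
    using u subtree_subset_labels[of "u @ [j]"] by (auto simp: K_def)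
  have "disjoint_family_on K UNIV"
    by (auto simp: disjoint_family_on_def K_def subtree_def)
  then have indK: "indep_vars (\<lambda>j. PiM (K j) (\<lambda>_. ?N)) X UNIV"
    unfolding X_def using K_labels by (intro indep_vars_restrict[OF ind]) auto
  have "Measurable.pred (PiM (K j) (\<lambda>_. ?N)) (P j)" for j
  proof (cases "j = 0")
    case True
    have [measurable]: "(\<lambda>x. x u) \<in> PiM (K j) (\<lambda>_. ?N) \<rightarrow>\<^sub>M ?N"
      using True by (intro measurable_component_singleton) (auto simp: K_def)
    have [measurable]: "(\<lambda>x. emeasure (x u) B) \<in> borel_measurable (PiM (K j) (\<lambda>_. ?N))"
      if "B \<in> sets half_line" for B
      using that by measurable
    have "Measurable.pred (PiM (K j) (\<lambda>_. ?N)) D"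
      unfolding D_def by measurable
    moreover have "P j = D"
      using True by (simp add: P_def fun_eq_iff)
    ultimately show ?thesis
      by simp
  next
    case False
    have "Measurable.pred (PiM (K j) (\<lambda>_. ?N)) (\<lambda>x. survives n (u @ [j]) (s j) (\<lambda>v. x v))"
      using False by (intro measurable_survives measurable_component_singleton) (auto simp: K_def)
    then show ?thesis
      using False unfolding P_def by simp
  qed
  then have A: "A j \<in> sets (PiM (K j) (\<lambda>_. ?N))" for j
    unfolding A_def by (rule predE)
  have P_X: "P j (X j \<omega>) \<longleftrightarrow> P j (\<lambda>v. \<Xi> v \<omega>)" for j \<omega>
  proof (cases "j = 0")
    case True
    then show ?thesis by (simp add: P_def D_def X_def K_def)
  next
    case False
    have "survives n (u @ [j]) (s j) (X j \<omega>) \<longleftrightarrow> survives n (u @ [j]) (s j) (\<lambda>v. \<Xi> v \<omega>)"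
      using False by (intro survives_cong) (simp add: X_def K_def)
    then show ?thesis using False by (simp add: P_def)
  qed
  have X_A: "X j -` A j \<inter> space M = {\<omega> \<in> space M. P j (\<lambda>v. \<Xi> v \<omega>)}" for j
  proof -
    have "X j \<omega> \<in> space (PiM (K j) (\<lambda>_. ?N))" if "\<omega> \<in> space M" for \<omega>
      using that indK by (auto simp: indep_vars_def dest: measurable_space)
    then show ?thesis
      by (auto simp: A_def P_X)
  qed
  have surv_sets: "{\<omega> \<in> space M. survives n (u @ [j]) r (\<lambda>v. \<Xi> v \<omega>)} \<in> events" if "1 \<le> j" for j r
    using subtree_subset_labels[of "u @ [j]"] u that
    by (intro predE measurable_survives \<Xi>) auto
  let ?B = "{\<omega> \<in> space M. D (\<lambda>v. \<Xi> v \<omega>) \<and> \<not> survives (Suc n) u t (\<lambda>v. \<Xi> v \<omega>)}"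
  let ?D = "{\<omega> \<in> space M. D (\<lambda>v. \<Xi> v \<omega>)}"
  have "?B \<subseteq> (\<Inter>j\<in>{..y + z}. X j -` A j \<inter> space M)"
  proof (intro subsetI INT_I)
    fix \<omega> j assume \<omega>: "\<omega> \<in> ?B" and j: "j \<in> {..y + z}"
    have "P j (\<lambda>v. \<Xi> v \<omega>)"
    proof (cases "j = 0")
      case False
      have "\<Xi> u \<omega> \<in> space ?N"
        using \<omega> measurable_space[OF \<Xi>[OF u]] by auto
      then have *: "emeasure (\<Xi> u \<omega>) {0..t / 2} = of_nat (y + z)"
        using \<omega> t by (simp add: point_measure_split D_def)
      have "of_nat j \<le> emeasure (\<Xi> u \<omega>) {0..t / 2}"
        unfolding * using j by (simp del: of_nat_add)
      then show ?thesis
        using \<omega> False by (auto simp: P_def s_def D_def)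
    qed (use \<omega> in \<open>simp add: P_def\<close>)
    then show "\<omega> \<in> X j -` A j \<inter> space M"
      using \<omega> by (simp add: X_A)
  qed
  then have "prob ?B \<le> prob (\<Inter>j\<in>{..y + z}. X j -` A j \<inter> space M)"
  proof (intro finite_measure_mono sets.finite_INT)
    show "X j -` A j \<inter> space M \<in> events" for j
      using indK A by (auto simp: indep_vars_def intro: measurable_sets)
  qed auto
  also have "\<dots> = (\<Prod>j\<in>{..y + z}. prob (X j -` A j \<inter> space M))"
    using A by (intro indep_varsD[OF indK]) auto
  also have "\<dots> = prob ?D * (\<Prod>j\<in>{1..y + z}. prob (X j -` A j \<inter> space M))"
  proof -
    have "{..y + z} = insert 0 {1..y + z}" by auto
    then show ?thesis
      by (simp add: X_A P_def)
  qed
  also have "\<dots> \<le> prob ?D * (\<Prod>j\<in>{1..y + z}. if j \<le> y then 1 - p else 1 - p / 2)"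
  proof (intro mult_left_mono prod_mono conjI)
    fix j assume j: "j \<in> {1..y + z}"
    then have "prob (X j -` A j \<inter> space M)
        = 1 - prob {\<omega> \<in> space M. survives n (u @ [j]) (s j) (\<lambda>v. \<Xi> v \<omega>)}"
      unfolding X_A P_def using surv_sets[of j "s j"] prob_neg by simp
    then show "prob (X j -` A j \<inter> space M) \<le> (if j \<le> y then 1 - p else 1 - p / 2)"
      using full[of j] half[of j] j by (auto simp: s_def)
  qed auto
  also have "(\<Prod>j\<in>{1..y + z}. if j \<le> y then 1 - p else 1 - p / 2) = (1 - p) ^ y * (1 - p / 2) ^ z"
  proof -
    have "{1..y + z} = {1..y} \<union> {y + 1..y + z}" by auto
    then show ?thesis
      by (simp add: prod.union_disjoint)
  qed
  finally show ?thesis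
    by (simp add: D_def)
qed

end

section \<open>Second-order bound for the product over the children\<close>

lemma exp_minus_le_quadratic:
  fixes x :: real
  assumes "0 \<le> x"
  shows "exp (- x) \<le> 1 - x + x\<^sup>2 / 2"
proof -
  have *: "0 \<le> 1 - x + x\<^sup>2 / 2"
    using zero_le_power2[of "x - 1"] by (simp add: power2_diff)
  \<comment> \<open>The product equals \<open>1 + x^4 / 4\<close>. Its first factor is at most
    \<open>exp x\<close>, so dividing by \<open>exp x\<close> gives the claim.\<close>
  have "1 \<le> (1 + x + x\<^sup>2 / 2) * (1 - x + x\<^sup>2 / 2)"
    using assms by (simp add: field_simps power2_eq_square)
  also have "\<dots> \<le> exp x * (1 - x + x\<^sup>2 / 2)"
    using exp_lower_Taylor_quadratic[OF assms] * by (intro mult_right_mono) auto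
  finally show ?thesis
    by (simp add: exp_minus field_simps)
qed

text \<open>Replacing each factor \<open>1 - q\<close> by \<open>exp (- q)\<close> turns the product
  into one exponential, to which the quadratic bound applies. The linear terms stand on the left so
  that the inequality can be integrated in \<open>ennreal\<close> without subtraction.\<close>

lemma product_le_second_order:
  fixes p :: real
  assumes "0 \<le> p" "p \<le> 1"
  shows "(1 - p) ^ y * (1 - p / 2) ^ z + p * real y + p / 2 * real z
    \<le> 1 + p\<^sup>2 / 2 * (real y + real z)\<^sup>2"
proof -
  define x where "x = p * real y + p / 2 * real z"
  have "0 \<le> x"
    using assms by (simp add: x_def)
  have "x \<le> p * (real y + real z)"
    using assms by (simp add: x_def distrib_left mult_right_mono)
  have "(1 - p) ^ y * (1 - p / 2) ^ z \<le> exp (- p) ^ y * exp (- (p / 2)) ^ z"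
    using exp_ge_add_one_self[of "- p"] exp_ge_add_one_self[of "- (p / 2)"] assms
    by (intro mult_mono power_mono) auto
  also have "\<dots> = exp (- x)"
    by (simp add: x_def algebra_simps flip: exp_of_nat_mult exp_add)
  also have "\<dots> \<le> 1 - x + x\<^sup>2 / 2"
    by (rule exp_minus_le_quadratic) fact
  also have "x\<^sup>2 \<le> (p * (real y + real z))\<^sup>2"
    by (intro power_mono) fact+
  finally show ?thesis
    by (simp add: x_def power_mult_distrib)
qed

section \<open>Passing from generation \<open>n\<close> to generation \<open>n + 1\<close>\<close>

context prob_space
begin

text \<open>Averaging the second-order bound over the offspring counts, the children at time 0
  contribute exactly \<open>p\<close>, as their mean number is 1. The gain from later children is
  \<open>p / 2\<close> times their mean number, and \<open>second\<close> makes it at least the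
  quadratic loss.\<close>

lemma prob_survives_Suc:
  fixes p :: real
  assumes ind: "indep_vars (\<lambda>_. point_measure_algebra half_line) \<Xi> labels"
    and u: "u \<in> labels" and t: "0 \<le> t" and p: "0 \<le> p" "p \<le> 1"
    and full: "\<And>j. 1 \<le> j \<Longrightarrow> p \<le> prob {\<omega> \<in> space M. survives n (u @ [j]) t (\<lambda>v. \<Xi> v \<omega>)}"
    and half: "\<And>j. 1 \<le> j \<Longrightarrow> p / 2 \<le> prob {\<omega> \<in> space M. survives n (u @ [j]) (t / 2) (\<lambda>v. \<Xi> v \<omega>)}"
    and fin: "AE \<omega> in M. emeasure (\<Xi> u \<omega>) {0..t / 2} < \<infinity>"
    and mean: "(\<integral>\<^sup>+\<omega>. emeasure (\<Xi> u \<omega>) {0} \<partial>M) = 1"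
    and second: "(\<integral>\<^sup>+\<omega>. (emeasure (\<Xi> u \<omega>) {0..t / 2})\<^sup>2 \<partial>M) < \<infinity>"
      "ennreal p * (\<integral>\<^sup>+\<omega>. (emeasure (\<Xi> u \<omega>) {0..t / 2})\<^sup>2 \<partial>M) \<le> (\<integral>\<^sup>+\<omega>. emeasure (\<Xi> u \<omega>) {0<..t / 2} \<partial>M)"
  shows "p \<le> prob {\<omega> \<in> space M. survives (Suc n) u t (\<lambda>v. \<Xi> v \<omega>)}"
proof -
  let ?N = "point_measure_algebra half_line"
  let ?Y = "\<lambda>\<omega>. emeasure (\<Xi> u \<omega>) {0}" and ?Z = "\<lambda>\<omega>. emeasure (\<Xi> u \<omega>) {0<..t / 2}"
  let ?W = "\<lambda>\<omega>. emeasure (\<Xi> u \<omega>) {0..t / 2}"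
  define S where "S = {\<omega> \<in> space M. survives (Suc n) u t (\<lambda>v. \<Xi> v \<omega>)}"
  \<comment> \<open>The cells \<open>D (y, z)\<close> split the space by offspring counts, up to a
    null set, and \<open>h\<close> is the bound for extinction within each cell.\<close>
  define D where "D = (\<lambda>(y, z). {\<omega> \<in> space M. ?Y \<omega> = of_nat y \<and> ?Z \<omega> = of_nat z})"
  define h where "h = (\<lambda>(y, z). (1 - p) ^ y * (1 - p / 2) ^ z)"
  have \<Xi> [measurable]: "\<Xi> v \<in> M \<rightarrow>\<^sub>M ?N" if "v \<in> labels" for v
    using ind that by (auto simp: indep_vars_def)
  have [measurable]: "(\<lambda>\<omega>. emeasure (\<Xi> u \<omega>) B) \<in> borel_measurable M" if "B \<in> sets half_line" for B
    using \<Xi>[OF u] that by measurable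
  have [measurable]: "S \<in> events"
    unfolding S_def using subtree_subset_labels[OF u] by (intro predE measurable_survives \<Xi>) auto
  have [measurable]: "D c \<in> events" for c
    unfolding D_def by (cases c) simp
  have h: "0 \<le> h c" for c
    using p by (auto simp: h_def split: prod.split)
  have W: "?W \<omega> = ?Y \<omega> + ?Z \<omega>" if "\<omega> \<in> space M" for \<omega>
    using measurable_space[OF \<Xi>[OF u] that] t by (simp add: point_measure_split)
  have AE_D: "AE \<omega> in M. \<omega> \<in> space M \<and> (\<exists>c. \<omega> \<in> D c)"
    using fin AE_space
  proof eventually_elim
    case (elim \<omega>)
    note sp = measurable_space[OF \<Xi>[OF u] elim(2)]
    have "?Y \<omega> < \<infinity>" "?Z \<omega> < \<infinity>"
      using elim W by auto
    with sp obtain y z where "?Y \<omega> = of_nat y" "?Z \<omega> = of_nat z"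
      by (metis point_measure_eq_of_nat half_line_sets(1,3))
    then show ?case
      using elim by (auto simp: D_def)
  qed
  have D_iff: "indicator (D c') \<omega> = indicator {c} c'" if "\<omega> \<in> D c" for c c' \<omega>
    using that by (auto simp: D_def indicator_def split: prod.splits)
  \<comment> \<open>The cells are disjoint, so a sum over all cells reduces to the value at the cell
    containing \<open>\<omega>\<close>.\<close>
  have pick: "(\<integral>\<^sup>+c'. f c' * indicator (D c') \<omega> \<partial>count_space UNIV) = f c" if "\<omega> \<in> D c"
    for f c \<omega>
    using that by (simp add: D_iff nn_integral_indicator_singleton)
  \<comment> \<open>Extinction is split over the cells, bounded cell by cell and reassembled; sum
    and integral are exchanged before and after.\<close>
  have "emeasure M (space M - S) = (\<integral>\<^sup>+\<omega>. indicator (space M - S) \<omega> \<partial>M)"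
    by simp
  also have "\<dots> = (\<integral>\<^sup>+\<omega>. (\<integral>\<^sup>+c. indicator (space M - S) \<omega> * indicator (D c) \<omega> \<partial>count_space UNIV) \<partial>M)"
    using AE_D by (intro nn_integral_cong_AE) (auto simp: pick)
  also have "\<dots> = (\<integral>\<^sup>+c. (\<integral>\<^sup>+\<omega>. indicator (space M - S) \<omega> * indicator (D c) \<omega> \<partial>M) \<partial>count_space UNIV)"
    by (intro nn_integral_count_space_nn_integral) auto
  also have "\<dots> \<le> (\<integral>\<^sup>+c. (\<integral>\<^sup>+\<omega>. ennreal (h c) * indicator (D c) \<omega> \<partial>M) \<partial>count_space UNIV)"
  proof (rule nn_integral_mono)
    fix c :: "nat \<times> nat"
    obtain y z where c: "c = (y, z)" by (cases c)
    have "(\<integral>\<^sup>+\<omega>. indicator (space M - S) \<omega> * indicator (D c) \<omega> \<partial>M)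
        = emeasure M ((space M - S) \<inter> D c)"
      by (simp flip: indicator_inter_arith)
    also have "(space M - S) \<inter> D c = {\<omega> \<in> space M. ?Y \<omega> = of_nat y \<and> ?Z \<omega> = of_nat z
           \<and> \<not> survives (Suc n) u t (\<lambda>v. \<Xi> v \<omega>)}"
      unfolding S_def D_def c by auto
    also have "emeasure M \<dots> \<le> ennreal (prob (D c) * h c)"
      using prob_extinct_given_offspring[OF ind u t p full half, of y z]
      unfolding emeasure_eq_measure D_def h_def c by (simp add: ennreal_leI)
    also have "\<dots> = (\<integral>\<^sup>+\<omega>. ennreal (h c) * indicator (D c) \<omega> \<partial>M)"
      using h by (simp add: nn_integral_cmult_indicator emeasure_eq_measure ennreal_mult mult.commute)
    finally show "(\<integral>\<^sup>+\<omega>. indicator (space M - S) \<omega> * indicator (D c) \<omega> \<partial>M)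
      \<le> (\<integral>\<^sup>+\<omega>. ennreal (h c) * indicator (D c) \<omega> \<partial>M)" .
  qed
  also have "\<dots> = (\<integral>\<^sup>+\<omega>. (\<integral>\<^sup>+c. ennreal (h c) * indicator (D c) \<omega> \<partial>count_space UNIV) \<partial>M)"
    by (intro nn_integral_count_space_nn_integral[symmetric]) auto
  finally have extinct: "emeasure M (space M - S)
    \<le> (\<integral>\<^sup>+\<omega>. (\<integral>\<^sup>+c. ennreal (h c) * indicator (D c) \<omega> \<partial>count_space UNIV) \<partial>M)" (is "_ \<le> (\<integral>\<^sup>+\<omega>. ?H \<omega> \<partial>M)") .
  have [measurable]: "?H \<in> borel_measurable M"
  \<comment> \<open>Enumerating the pairs by \<open>prod_decode\<close> turns the integral over the
    counting measure into a series of measurable functions.\<close>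
  proof -
    have "?H \<omega> = (\<Sum>n. ennreal (h (prod_decode n)) * indicator (D (prod_decode n)) \<omega>)" for \<omega>
      by (subst nn_integral_bij_count_space[OF bij_prod_decode, symmetric])
        (rule nn_integral_count_space_nat)
    then show ?thesis
      by simp
  qed
  \<comment> \<open>The quadratic term is grouped as \<open>p / 2\<close> times
    \<open>p * r\<^sup>2\<close> so that, once integrated, \<open>second(2)\<close> multiplied by
    \<open>p / 2\<close> bounds it.\<close>
  have expand: "ennreal (1 + p / 2 * (p * r\<^sup>2)) = 1 + ennreal (p / 2) * (ennreal p * (ennreal r)\<^sup>2)"
    if "0 \<le> r" for r
    using p that by (simp add: ennreal_mult ennreal_power del: times_divide_eq_left times_divide_eq_right)
  have "(\<integral>\<^sup>+\<omega>. ?H \<omega> \<partial>M) + ennreal p + ennreal (p / 2) * (\<integral>\<^sup>+\<omega>. ?Z \<omega> \<partial>M)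
      = (\<integral>\<^sup>+\<omega>. ?H \<omega> + ennreal p * ?Y \<omega> + ennreal (p / 2) * ?Z \<omega> \<partial>M)"
    by (simp add: nn_integral_add nn_integral_cmult mean)
  also have "\<dots> \<le> (\<integral>\<^sup>+\<omega>. 1 + ennreal (p / 2) * (ennreal p * (?W \<omega>)\<^sup>2) \<partial>M)"
  proof (intro nn_integral_mono_AE, use AE_D in eventually_elim)
    case (elim \<omega>)
    then obtain y z where \<omega>: "\<omega> \<in> D (y, z)" by auto
    then have YZ: "?Y \<omega> = ennreal (real y)" "?Z \<omega> = ennreal (real z)"
      by (auto simp: D_def ennreal_of_nat_eq_real_of_nat)
    have W': "?W \<omega> = ennreal (real y + real z)"
      using W[of \<omega>] elim by (simp add: YZ)
    have "?H \<omega> + ennreal p * ?Y \<omega> + ennreal (p / 2) * ?Z \<omega>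
        = ennreal (h (y, z) + p * real y + p / 2 * real z)"
      unfolding pick[OF \<omega>] YZ using p h[of "(y, z)"]
      by (simp add: ennreal_mult del: times_divide_eq_left)
    also have "\<dots> \<le> ennreal (1 + p / 2 * (p * (real y + real z)\<^sup>2))"
      using product_le_second_order[OF p, of y z]
      by (intro ennreal_leI) (simp add: h_def power2_eq_square mult.assoc)
    also have "\<dots> = 1 + ennreal (p / 2) * (ennreal p * (?W \<omega>)\<^sup>2)"
      unfolding W' by (rule expand) simp
    finally show ?case .
  qed
  also have "\<dots> = 1 + ennreal (p / 2) * (ennreal p * (\<integral>\<^sup>+\<omega>. (?W \<omega>)\<^sup>2 \<partial>M))"
    by (simp add: nn_integral_add nn_integral_cmult emeasure_space_1)
  finally have "emeasure M (space M - S) + ennreal p + ennreal (p / 2) * (\<integral>\<^sup>+\<omega>. ?Z \<omega> \<partial>M)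
      \<le> 1 + ennreal (p / 2) * (ennreal p * (\<integral>\<^sup>+\<omega>. (?W \<omega>)\<^sup>2 \<partial>M))"
    using extinct by (meson add_right_mono order.trans)
  moreover have "ennreal (p / 2) * (ennreal p * (\<integral>\<^sup>+\<omega>. (?W \<omega>)\<^sup>2 \<partial>M)) \<le> ennreal (p / 2) * (\<integral>\<^sup>+\<omega>. ?Z \<omega> \<partial>M)"
    using second by (intro mult_left_mono) auto
  \<comment> \<open>The quadratic term may replace the larger gain on the left; being finite, it
    then cancels from both sides in \<open>ennreal\<close>.\<close>
  moreover have "ennreal (p / 2) * (ennreal p * (\<integral>\<^sup>+\<omega>. (?W \<omega>)\<^sup>2 \<partial>M)) < \<infinity>"
    using second(1) by (simp add: ennreal_mult_less_top)
  ultimately have "emeasure M (space M - S) + ennreal p \<le> 1"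
    by (smt (verit) add_left_mono add.commute ennreal_add_left_cancel_le infinity_ennreal_def order.strict_iff_order order.trans)
  then have "prob (space M - S) + p \<le> 1"
    using p by (simp add: emeasure_eq_measure flip: ennreal_plus)
  then show ?thesis
    unfolding S_def[symmetric] using prob_compl[of S] by simp
qed

end

section \<open>Explosion\<close>

lemma iid_copies_measurable:
  "iid_copies M \<xi> Q \<Xi> \<Longrightarrow> u \<in> labels \<Longrightarrow> \<Xi> u \<in> Q \<rightarrow>\<^sub>M point_measure_algebra half_line"
  unfolding iid_copies_def by (auto simp: prob_space.indep_vars_def)

lemma nn_integral_iid_copy:
  assumes "reproduction_process M \<xi>" "iid_copies M \<xi> Q \<Xi>" "u \<in> labels"
    and f: "f \<in> borel_measurable (point_measure_algebra half_line)"
  shows "(\<integral>\<^sup>+\<omega>. f (\<Xi> u \<omega>) \<partial>Q) = (\<integral>\<^sup>+\<omega>. f (\<xi> \<omega>) \<partial>M)"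
proof -
  let ?N = "point_measure_algebra half_line"
  have \<xi>: "\<xi> \<in> M \<rightarrow>\<^sub>M ?N"
    using assms by (simp add: reproduction_process_def)
  have "(\<integral>\<^sup>+\<omega>. f (\<Xi> u \<omega>) \<partial>Q) = (\<integral>\<^sup>+m. f m \<partial>distr Q ?N (\<Xi> u))"
    using iid_copies_measurable[OF assms(2,3)] f by (simp add: nn_integral_distr)
  also have "\<dots> = (\<integral>\<^sup>+m. f m \<partial>distr M ?N \<xi>)"
    using assms by (simp add: iid_copies_def)
  also have "\<dots> = (\<integral>\<^sup>+\<omega>. f (\<xi> \<omega>) \<partial>M)"
    using \<xi> f by (simp add: nn_integral_distr)
  finally show ?thesis .
qed

lemma AE_iid_copy_locally_finite:
  assumes "reproduction_process M \<xi>" "iid_copies M \<xi> Q \<Xi>" "u \<in> labels" "0 \<le> t"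
  shows "AE \<omega> in Q. emeasure (\<Xi> u \<omega>) {0..t} < \<infinity>"
proof -
  let ?N = "point_measure_algebra half_line"
  have \<xi>: "\<xi> \<in> M \<rightarrow>\<^sub>M ?N" and fin: "AE \<omega> in M. emeasure (\<xi> \<omega>) {0..t} < \<infinity>"
    using assms by (auto simp: reproduction_process_def)
  have sets: "{m \<in> space ?N. emeasure m {0..t} < \<infinity>} \<in> sets ?N"
    by measurable
  have "AE m in distr M ?N \<xi>. emeasure m {0..t} < \<infinity>"
    using fin by (simp only: AE_distr_iff[OF \<xi> sets])
  also have "distr M ?N \<xi> = distr Q ?N (\<Xi> u)"
    using assms by (simp add: iid_copies_def)
  finally show ?thesis
    by (simp only: AE_distr_iff[OF iid_copies_measurable[OF assms(2,3)] sets])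
qed

text \<open>A linear bound reproduces itself: halving \<open>t\<close> halves \<open>a * t\<close>,
  which is the form the recursion asks of children born after time 0. The induction covers all
  \<open>u\<close> and \<open>t\<close> together, since children change both;
  \<open>a * T \<le> 1\<close> serves the start and keeps the bound a probability.\<close>

lemma prob_survives_ge_linear:
  assumes rep: "reproduction_process M \<xi>" and iid: "iid_copies M \<xi> Q \<Xi>"
    and crit: "intensity M \<xi> {0} = 1"
    and fin: "(\<integral>\<^sup>+\<omega>. (emeasure (\<xi> \<omega>) {0..T})\<^sup>2 \<partial>M) < \<infinity>"
    and a: "0 \<le> a" "a * T \<le> 1"
    and growth: "\<And>t. 0 < t \<Longrightarrow> t \<le> T \<Longrightarrow>
      ennreal (a * t) * (\<integral>\<^sup>+\<omega>. (emeasure (\<xi> \<omega>) {0..T})\<^sup>2 \<partial>M) \<le> intensity M \<xi> {0<..t / 2}"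
  shows "u \<in> labels \<Longrightarrow> 0 < t \<Longrightarrow> t \<le> T \<Longrightarrow>
    a * t \<le> measure Q {\<omega> \<in> space Q. survives n u t (\<lambda>v. \<Xi> v \<omega>)}"
proof (induction n arbitrary: u t)
  case 0
  interpret Q: prob_space Q using iid by (simp add: iid_copies_def)
  have "a * t \<le> a * T"
    using 0 a by (intro mult_left_mono) auto
  then show ?case
    using a by (simp add: Q.prob_space)
next
  case (Suc n)
  interpret Q: prob_space Q using iid by (simp add: iid_copies_def)
  let ?N = "point_measure_algebra half_line"
  note t = Suc.prems(2,3)
  have at: "a * t \<le> a * T"
    using t a by (intro mult_left_mono) auto
  note transfer = nn_integral_iid_copy[OF rep iid Suc.prems(1)]
  have sq: "(\<lambda>m. (emeasure m {0..t / 2})\<^sup>2) \<in> borel_measurable ?N"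
    by measurable
  \<comment> \<open>The second moment over the fixed window \<open>{0..T}\<close> dominates that
    over \<open>{0..t / 2}\<close>, so one constant serves every \<open>t\<close>.\<close>
  have mono: "(\<integral>\<^sup>+\<omega>. (emeasure (\<xi> \<omega>) {0..t / 2})\<^sup>2 \<partial>M) \<le> (\<integral>\<^sup>+\<omega>. (emeasure (\<xi> \<omega>) {0..T})\<^sup>2 \<partial>M)"
  proof (intro nn_integral_mono power_mono emeasure_mono)
    fix \<omega> assume "\<omega> \<in> space M"
    then have "\<xi> \<omega> \<in> space ?N"
      using rep by (auto simp: reproduction_process_def dest: measurable_space)
    then show "{0..T} \<in> sets (\<xi> \<omega>)"
      by (simp add: space_point_measure_algebra)
  qed (use t in auto)
  show ?case
  proof (rule Q.prob_survives_Suc)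
    show "Q.indep_vars (\<lambda>_. ?N) \<Xi> labels"
      using iid by (simp add: iid_copies_def)
    show "u \<in> labels" "0 \<le> t" "0 \<le> a * t" "a * t \<le> 1"
      using Suc.prems a at by auto
    show "a * t \<le> Q.prob {\<omega> \<in> space Q. survives n (u @ [j]) t (\<lambda>v. \<Xi> v \<omega>)}" if "1 \<le> j" for j
      using Suc.prems that by (intro Suc.IH) auto
    show "a * t / 2 \<le> Q.prob {\<omega> \<in> space Q. survives n (u @ [j]) (t / 2) (\<lambda>v. \<Xi> v \<omega>)}" if "1 \<le> j" for j
      using Suc.IH[of "u @ [j]" "t / 2"] Suc.prems that by auto
    show "AE \<omega> in Q. emeasure (\<Xi> u \<omega>) {0..t / 2} < \<infinity>"
      using AE_iid_copy_locally_finite[OF rep iid Suc.prems(1)] t by simp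
    show "(\<integral>\<^sup>+\<omega>. emeasure (\<Xi> u \<omega>) {0} \<partial>Q) = 1"
      using crit transfer[of "\<lambda>m. emeasure m {0}"] by (simp add: intensity_def)
    show "(\<integral>\<^sup>+\<omega>. (emeasure (\<Xi> u \<omega>) {0..t / 2})\<^sup>2 \<partial>Q) < \<infinity>"
      unfolding transfer[OF sq] using mono fin by (rule le_less_trans)
    have "ennreal (a * t) * (\<integral>\<^sup>+\<omega>. (emeasure (\<xi> \<omega>) {0..t / 2})\<^sup>2 \<partial>M) \<le> intensity M \<xi> {0<..t / 2}"
      using mult_left_mono[OF mono, of "ennreal (a * t)"] growth[OF t] by auto
    then show "ennreal (a * t) * (\<integral>\<^sup>+\<omega>. (emeasure (\<Xi> u \<omega>) {0..t / 2})\<^sup>2 \<partial>Q)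
        \<le> (\<integral>\<^sup>+\<omega>. emeasure (\<Xi> u \<omega>) {0<..t / 2} \<partial>Q)"
      unfolding transfer[OF sq] using transfer[of "\<lambda>m. emeasure m {0<..t / 2}"]
      by (simp add: intensity_def)
  qed
qed

lemma explosion_time_finite_if_survives:
  assumes "\<And>n. survives n [] t x" "0 \<le> t"
  shows "explosion_time x < \<infinity>"
proof -
  let ?A = "{u \<in> labels. birth_time x u \<le> ennreal t}"
  \<comment> \<open>Labels of every length are born by time \<open>t\<close>, so there are
    infinitely many of them.\<close>
  have "n \<in> length ` ?A" for n
    using survives_imp_born[OF assms(1) assms(2), of n] by auto
  then have "length ` ?A = UNIV"
    by blast
  then have "infinite ?A"
    using infinite_UNIV_nat by (metis finite_imageI)
  then have "num_born x t = \<infinity>"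
    by (simp add: num_born_def emeasure_count_space)
  then have "explosion_time x \<le> ennreal t"
    unfolding explosion_time_def using assms by (intro Inf_lower) auto
  then show ?thesis
    using ennreal_less_top[of t] by (simp add: le_less_trans)
qed

text \<open>By continuity from above the uniform bound \<open>c\<close> passes to the event of
  survival for all \<open>n\<close>, on which explosion occurs.\<close>

lemma explosive_if_survival_bounded_below:
  assumes iid: "iid_copies M \<xi> Q \<Xi>" and "0 \<le> t" "0 < c"
    and c: "\<And>n. c \<le> measure Q {\<omega> \<in> space Q. survives n [] t (\<lambda>v. \<Xi> v \<omega>)}"
  shows "explosive_CMJ Q \<Xi>"
proof -
  interpret Q: prob_space Q using iid by (simp add: iid_copies_def)
  define S where "S n = {\<omega> \<in> space Q. survives n [] t (\<lambda>v. \<Xi> v \<omega>)}" for n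
  have "range S \<subseteq> Q.events"
    unfolding S_def using subtree_subset_labels[of "[]"]
    by (auto intro!: predE measurable_survives iid_copies_measurable[OF iid])
  moreover have "decseq S"
    unfolding S_def by (intro decseq_SucI) (auto dest: survives_Suc_imp simp del: survives.simps)
  ultimately have "(\<lambda>n. Q.prob (S n)) \<longlonglongrightarrow> Q.prob (\<Inter>n. S n)"
    by (rule Q.finite_Lim_measure_decseq)
  then have "c \<le> Q.prob (\<Inter>n. S n)"
    by (rule LIMSEQ_le_const) (use c in \<open>auto simp: S_def\<close>)
  also have "\<dots> \<le> Q.prob {\<omega> \<in> space Q. explosion_time (\<lambda>u. \<Xi> u \<omega>) < \<infinity>}"
  proof (rule Q.finite_measure_mono)
    show "(\<Inter>n. S n) \<subseteq> {\<omega> \<in> space Q. explosion_time (\<lambda>u. \<Xi> u \<omega>) < \<infinity>}"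
    proof
      fix \<omega> assume "\<omega> \<in> (\<Inter>n. S n)"
      then have "\<omega> \<in> space Q" and surv: "\<And>n. survives n [] t (\<lambda>v. \<Xi> v \<omega>)"
        unfolding S_def by blast+
      then show "\<omega> \<in> {\<omega> \<in> space Q. explosion_time (\<lambda>u. \<Xi> u \<omega>) < \<infinity>}"
        using explosion_time_finite_if_survives[OF surv assms(2)] by simp
    qed
    show "{\<omega> \<in> space Q. explosion_time (\<lambda>u. \<Xi> u \<omega>) < \<infinity>} \<in> Q.events"
      by (rule measurable_explosion) (rule iid_copies_measurable[OF iid])
  qed
  finally show ?thesis
    using assms by (simp add: explosive_CMJ_def)
qed

text \<open>Below \<open>exp (- 1)\<close> one has \<open>\<bar>ln t\<bar> > 1\<close>, so the
  denominator is at least \<open>t\<close> and a positive lower bound for the ratio yields linear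
  growth.\<close>

lemma linear_growth_if_Liminf_pos:
  fixes f :: "real \<Rightarrow> ennreal"
  assumes "0 < \<delta>" "Liminf (at_right 0) (\<lambda>t. f t / ennreal (t * \<bar>ln t\<bar> powr (1 + \<delta>))) > 0"
  shows "\<exists>c>0. \<exists>b>0. \<forall>t. 0 < t \<longrightarrow> t < b \<longrightarrow> ennreal (c * t) \<le> f t"
proof -
  \<comment> \<open>The \<open>Liminf\<close> may be infinite; a value strictly below it is finite
    and bounds the ratio near 0.\<close>
  obtain c' where c': "0 < c'" "c' < Liminf (at_right 0) (\<lambda>t. f t / ennreal (t * \<bar>ln t\<bar> powr (1 + \<delta>)))"
    using dense[OF assms(2)] by blast
  then obtain c where c: "0 < c" "c' = ennreal c"
    by (cases c') auto
  from less_LiminfD[OF c'(2)] obtain b where b: "0 < b"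
    "\<And>t. 0 < t \<Longrightarrow> t < b \<Longrightarrow> c' < f t / ennreal (t * \<bar>ln t\<bar> powr (1 + \<delta>))"
    by (auto simp: eventually_at_right_field)
  have "ennreal (c * t) \<le> f t" if t: "0 < t" "t < min b (exp (- 1))" for t
  proof -
    let ?d = "t * \<bar>ln t\<bar> powr (1 + \<delta>)"
    have "ln t < - 1"
      using t by (metis exp_less_cancel_iff exp_ln min_less_iff_conj)
    then have "1 \<le> \<bar>ln t\<bar> powr (1 + \<delta>)"
      using assms(1) by (intro ge_one_powr_ge_zero) auto
    then have d: "t \<le> ?d"
      using t by simp
    have "ennreal (c * t) \<le> ennreal (c * ?d)"
      using c d by (intro ennreal_leI mult_left_mono) auto
    also have "\<dots> = c' * ennreal ?d"
      using c t by (simp add: ennreal_mult)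
    also have "\<dots> \<le> f t / ennreal ?d * ennreal ?d"
      using b(2)[of t] t by (intro mult_right_mono) auto
    also have "\<dots> = f t"
    proof -
      have "ennreal ?d \<noteq> 0" "ennreal ?d \<noteq> top"
        using d t(1) by (simp_all only: ennreal_eq_0_iff ennreal_neq_top not_le not_False_eq_True)
      then show ?thesis
        by (metis ennreal_times_divide mult.commute mult_divide_eq_ennreal)
    qed
    finally show ?thesis .
  qed
  with c b show ?thesis
    by (intro exI[of _ c] exI[of _ "min b (exp (- 1))"] conjI) auto
qed

theorem theorem2p4:
  fixes M :: "'a measure" and \<xi> :: "'a \<Rightarrow> real measure"
    and Q :: "'b measure" and \<Xi> :: "nat list \<Rightarrow> 'b \<Rightarrow> real measure"
  assumes "reproduction_process M \<xi>"
    and "measure M {\<omega> \<in> space M. emeasure (\<xi> \<omega>) {0} = 1} < 1"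
    and "intensity M \<xi> {0} = 1"
    and "\<exists>t>0. intensity M \<xi> {0<..t} < \<infinity>"
    and "\<forall>t>0. intensity M \<xi> {0<..t} > 0"
    and "\<exists>\<epsilon>>0. (\<integral>\<^sup>+\<omega>. (emeasure (\<xi> \<omega>) {0..\<epsilon>})\<^sup>2 \<partial>M) < \<infinity>"
    and "\<exists>\<delta>>0. Liminf (at_right 0)
           (\<lambda>t. intensity M \<xi> {0<..t} / ennreal (t * \<bar>ln t\<bar> powr (1 + \<delta>))) > 0"
    and "iid_copies M \<xi> Q \<Xi>"
  shows "explosive_CMJ Q \<Xi>"
proof -
  obtain \<epsilon> where \<epsilon>: "0 < \<epsilon>" "(\<integral>\<^sup>+\<omega>. (emeasure (\<xi> \<omega>) {0..\<epsilon>})\<^sup>2 \<partial>M) < \<infinity>"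
    using assms(6) by blast
  obtain \<delta> where \<delta>: "0 < \<delta>"
    "Liminf (at_right 0) (\<lambda>t. intensity M \<xi> {0<..t} / ennreal (t * \<bar>ln t\<bar> powr (1 + \<delta>))) > 0"
    using assms(7) by blast
  obtain c b where cb: "0 < c" "0 < b"
    "\<And>t. 0 < t \<Longrightarrow> t < b \<Longrightarrow> ennreal (c * t) \<le> intensity M \<xi> {0<..t}"
    using linear_growth_if_Liminf_pos[OF \<delta>] by auto
  define T where "T = min \<epsilon> b"
  let ?K = "\<integral>\<^sup>+\<omega>. (emeasure (\<xi> \<omega>) {0..T})\<^sup>2 \<partial>M"
  have "0 < T"
    using \<epsilon> cb by (simp add: T_def)
  have "?K \<le> (\<integral>\<^sup>+\<omega>. (emeasure (\<xi> \<omega>) {0..\<epsilon>})\<^sup>2 \<partial>M)"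
  proof (intro nn_integral_mono power_mono emeasure_mono)
    fix \<omega> assume "\<omega> \<in> space M"
    then have "\<xi> \<omega> \<in> space (point_measure_algebra half_line)"
      using assms(1) by (auto simp: reproduction_process_def dest: measurable_space)
    then show "{0..\<epsilon>} \<in> sets (\<xi> \<omega>)"
      by (simp add: space_point_measure_algebra)
  qed (auto simp: T_def)
  then have K_fin: "?K < \<infinity>"
    using \<epsilon> by (meson le_less_trans)
  then obtain k where k: "0 \<le> k" "?K = ennreal k"
    by (cases ?K) auto
  \<comment> \<open>The first entry gives \<open>a * T \<le> 1\<close>, the second
    \<open>a * k \<le> c / 2\<close>; the summand 1 keeps its denominator positive when
    \<open>k = 0\<close>. The factor 1/2 is needed because growth is evaluated at
    \<open>t / 2\<close>, where only \<open>c * (t / 2)\<close> is available.\<close>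
  define a where "a = min (1 / T) (c / (2 * (k + 1)))"
  have a: "0 < a" "a * T \<le> 1" "a * k \<le> c / 2"
  proof -
    show "0 < a"
      using \<open>0 < T\<close> cb k by (simp add: a_def)
    show "a * T \<le> 1"
      using mult_right_mono[of a "1 / T" T] \<open>0 < T\<close> by (simp add: a_def)
    have "a * k \<le> c / (2 * (k + 1)) * (k + 1)"
      using k cb \<open>0 < T\<close> by (intro mult_mono) (auto simp: a_def)
    also have "c / (2 * (k + 1)) * (k + 1) = c / 2"
      using k by (simp add: divide_simps)
    finally show "a * k \<le> c / 2" .
  qed
  have growth: "ennreal (a * t) * ?K \<le> intensity M \<xi> {0<..t / 2}" if t: "0 < t" "t \<le> T" for t
  proof -
    have "ennreal (a * t) * ?K = ennreal (a * k * t)"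
      using a k t by (simp add: ac_simps flip: ennreal_mult)
    also have "\<dots> \<le> ennreal (c * (t / 2))"
      using mult_right_mono[OF a(3), of t] t by (intro ennreal_leI) simp
    also have "\<dots> \<le> intensity M \<xi> {0<..t / 2}"
      using t by (intro cb(3)) (auto simp: T_def)
    finally show ?thesis .
  qed
  \<comment> \<open>At the root with the full budget \<open>T\<close>, the bound is positive and
    independent of \<open>n\<close>.\<close>
  have "a * T \<le> measure Q {\<omega> \<in> space Q. survives n [] T (\<lambda>v. \<Xi> v \<omega>)}" for n
    using a \<open>0 < T\<close>
    by (intro prob_survives_ge_linear[OF assms(1,8,3) K_fin _ _ growth]) auto
  with assms(8) show ?thesis
    using a \<open>0 < T\<close> by (intro explosive_if_survival_bounded_below[of M \<xi> Q \<Xi> T "a * T"]) auto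
qed

end
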